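(* Let $\psi$ be a normalized $\mathrm{3LQST_0}^R$-conjunction and let $\mathcal M=(D,M)$ be a $\mathrm{3LQST_0}$-interpretation with $\mathcal M\models\psi$. Let $\mathcal V_0^\psi$, $\mathcal V_1^\psi$ be the sets of variables of sort 0 and 1 occurring in $\psi$, and let $l_\psi$ be the smallest number with $k\le l_\psi$ for every finite enumeration $\{x_1,\dots,x_k\}$ occurring in $\psi$. Let $\psi_1,\dots,\psi_h$ be the conjuncts of $\psi$ that are purely universal of level 1; for $\psi_i=(\forall Z_{i1})\dots(\forall Z_{im_i})\varphi_i$ let $\varphi_{i1},\dots,\varphi_{i\ell_i}$ be the propositional components of $\varphi_i$, whose arguments are $Z_{i1},\dots,Z_{im_i}$, and let $\Phi=\{\varphi_{ij}\}$. Let $D_0\subseteq D$ satisfy $MX\cap D_0\ne MY\cap D_0$ for all $X,Y\in\mathcal V_1^\psi$ with $MX\ne MY$, and $|D_0|\le|\mathcal V_1^\psi|-1$; let $D_1\subseteq D$ satisfy $|MX\cap D_1|\ge\min(l_\psi+1,|MX|)$ for every $X\in\mathcal V_1^\psi$. Let $D^*$ be obtained by starting from $\{Mx:x\in\mathcal V_0^\psi\}\cup D_0\cup D_1$ and then, for each $\varphi\in\Phi$ of the form $(\forall z_1)\dots(\forall z_n)\varphi_0$ with arguments $Z_1,\dots,Z_m$ and each $m$-tuple $(X_{i_1},\dots,X_{i_m})$ of variables in $\mathcal V_1^\psi$ with $\mathcal M\not\models\varphi^{Z_1,\dots,Z_m}_{X_{i_1},\dots,X_{i_m}}$, adding elements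 $u_1,\dots,u_n\in D$ with $\mathcal M[z_1/u_1,\dots,z_n/u_n]\not\models(\varphi_0)^{Z_1,\dots,Z_m}_{X_{i_1},\dots,X_{i_m}}$. Let $d^*\in D^*$. Then $\mathrm{Rel}(\mathcal M,D^*,d^*,\mathcal V_0^\psi,\mathcal V_1^\psi,l_\psi)\models\psi$.
   Context: Language $\mathrm{3LQST_0}$: sorts $\mathcal V_0$ (individual), $\mathcal V_1$ (set), $\mathcal V_2$ (collection variables); finite enumerations $\{x_1,\dots,x_k\}$, $x_i\in\mathcal V_0$, $k>0$. Level-0 atoms: $x=y$, $x\in X$, $\{x_1,\dots,x_k\}=X$, $\{x_1,\dots,x_k\}\in A$; level-1 atoms: $X=Y$, $X\in A$. Purely universal level-0 formula: $(\forall z_1)\dots(\forall z_n)\varphi_0$, $n\ge1$, $z_i\in\mathcal V_0$, $\varphi_0$ a propositional combination of level-0 atoms. Purely universal level-1 formula: $(\forall Z_1)\dots(\forall Z_m)\varphi_1$, $m\ge1$, $Z_j\in\mathcal V_1$, $\varphi_1$ a propositional combination of quantifier-free atoms of any level and purely universal level-0 formulae (these are the propositional components of $\varphi_1$). Interpretation $(D,M)$: $D\neq\emptyset$, $Mx\in D$, $MX\subseteq D$, $MA\subseteq\mathrm{pow}(D)$; $\{x_1,\dots,x_k\}$ denotes $\{Mx_1,\dots,Mx_k\}$; $(\forall z)$ ranges over $D$, $(\forall Z)$ over subsets of $D$. $\mathcal M[z_1/u_1,\dots]$ denotes the interpretation that agrees with $M$ except it sends $z_i$ to $u_i$. $\varphi^{Z_1,\dots,Z_m}_{X_1,\dots,X_m}$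 is the result of simultaneously replacing $Z_j$ by $X_j$ in $\varphi$. A purely universal level-0 formula $(\forall z_1)\dots(\forall z_n)\varphi_0$ is linked to $Z_1,\dots,Z_m$ if $\neg\varphi_0\rightarrow\bigwedge_{i,j}z_i\in Z_j$ is valid. A normalized $\mathrm{3LQST_0}^R$-conjunction is a conjunction of: level-0 and level-1 quantifier-free atoms and their negations; purely universal level-0 formulae; and purely universal level-1 formulae $(\forall Z_1)\dots(\forall Z_m)\varphi_1$ all of whose level-0 purely universal components are linked to $Z_1,\dots,Z_m$; moreover no bound variable is bound by more than one quantifier and no variable has both free and bound occurrences. Relativized interpretation: for $D^*\subseteq D$, $d^*\in D^*$, $\mathcal V_0'\subseteq\mathcal V_0$, $\mathcal V_1'\subseteq\mathcal V_1$, $l>0$, $\mathrm{Rel}(\mathcal M,D^*,d^*,\mathcal V_0',\mathcal V_1',l)=(D^*,M^* )$ where $M^*x=Mx$ if $Mx\in D^*$ and $M^*x=d^*$ otherwise; $M^*X=MX\cap D^*$; and $M^*A=\big((MA\cap\mathrm{pow}(D^* ))\setminus(\{M^*X:X\in\mathcal V_1'\}\cup\mathrm{pow}_{\le l}(S))\big)\cup\{M^*X:X\in\mathcal V_1',MX\in MA\}\cup(\mathrm{pow}_{\le l}(S)\cap MA)$, with $S=\{M^*x:x\in\mathcal V_0'\}$ and $\mathrm{pow}_{\le l}(S)$ the set of subsets of $S$ with at most $l$ elements. *)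

theory Defs
  imports Main "HOL-Library.Extended_Nat"
begin

section \<open>Syntax\<close>

text \<open>The three sorts of variables are kept apart by position: the same number may name an
  individual, a set and a collection variable without these being identified.\<close>

type_synonym var0 = nat
type_synonym var1 = nat
type_synonym var2 = nat

datatype 'a pform =
    Atom 'a
  | Neg "'a pform"
  | And "'a pform" "'a pform"
  | Or "'a pform" "'a pform"
  | Imp "'a pform" "'a pform"
  | Iff "'a pform" "'a pform"

text \<open>Components are listed with repetitions, so that quantifier occurrences can be counted.\<close>

fun components :: "'a pform \<Rightarrow> 'a list" where
  "components (Atom a) = [a]"
| "components (Neg p) = components p"
| "components (And p q) = components p @ components q"
| "components (Or p q) = components p @ components q"
| "components (Imp p q) = components p @ components q"
| "components (Iff p q) = components p @ components q"

text \<open>A list \<open>xs\<close> in \<open>EnumEq xs X\<close> (that is, \<open>{x1,...,xk} = X\<close>) or \<open>EnumIn xs A\<close>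
  (that is, \<open>{x1,...,xk} \<in> A\<close>) is a finite enumeration; non-emptiness of enumerations and
  of quantifier prefixes is part of \<open>normalized\<close> below.\<close>

datatype atom0 =
    Eq0 var0 var0
  | In0 var0 var1
  | EnumEq "var0 list" var1
  | EnumIn "var0 list" var2

datatype atom1 =
    Eq1 var1 var1
  | In1 var1 var2

datatype qf_atom = Lev0 atom0 | Lev1 atom1

datatype pu0 = All0 "var0 list" "atom0 pform"

datatype comp1 = QF qf_atom | PU0 pu0

datatype pu1 = All1 "var1 list" "comp1 pform"

datatype conjunct =
    PosLit qf_atom
  | NegLit qf_atom
  | CPU0 pu0
  | CPU1 pu1

text \<open>A list of conjuncts stands for their conjunction.\<close>

type_synonym conjunction = "conjunct list"


subsection \<open>Variables and enumerations\<close>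

fun vars0_atom0 :: "atom0 \<Rightarrow> var0 set" where
  "vars0_atom0 (Eq0 x y) = {x, y}"
| "vars0_atom0 (In0 x X) = {x}"
| "vars0_atom0 (EnumEq xs X) = set xs"
| "vars0_atom0 (EnumIn xs A) = set xs"

fun vars1_atom0 :: "atom0 \<Rightarrow> var1 set" where
  "vars1_atom0 (Eq0 x y) = {}"
| "vars1_atom0 (In0 x X) = {X}"
| "vars1_atom0 (EnumEq xs X) = {X}"
| "vars1_atom0 (EnumIn xs A) = {}"

fun vars1_atom1 :: "atom1 \<Rightarrow> var1 set" where
  "vars1_atom1 (Eq1 X Y) = {X, Y}"
| "vars1_atom1 (In1 X A) = {X}"

fun vars0_qf :: "qf_atom \<Rightarrow> var0 set" where
  "vars0_qf (Lev0 a) = vars0_atom0 a"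
| "vars0_qf (Lev1 a) = {}"

fun vars1_qf :: "qf_atom \<Rightarrow> var1 set" where
  "vars1_qf (Lev0 a) = vars1_atom0 a"
| "vars1_qf (Lev1 a) = vars1_atom1 a"

fun bound0_pu0 :: "pu0 \<Rightarrow> var0 list" where
  "bound0_pu0 (All0 zs p) = zs"

fun free0_pu0 :: "pu0 \<Rightarrow> var0 set" where
  "free0_pu0 (All0 zs p) = (\<Union>a\<in>set (components p). vars0_atom0 a) - set zs"

fun free1_pu0 :: "pu0 \<Rightarrow> var1 set" where
  "free1_pu0 (All0 zs p) = (\<Union>a\<in>set (components p). vars1_atom0 a)"

fun bound0_comp1 :: "comp1 \<Rightarrow> var0 list" where
  "bound0_comp1 (QF a) = []"
| "bound0_comp1 (PU0 q) = bound0_pu0 q"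

fun free0_comp1 :: "comp1 \<Rightarrow> var0 set" where
  "free0_comp1 (QF a) = vars0_qf a"
| "free0_comp1 (PU0 q) = free0_pu0 q"

fun free1_comp1 :: "comp1 \<Rightarrow> var1 set" where
  "free1_comp1 (QF a) = vars1_qf a"
| "free1_comp1 (PU0 q) = free1_pu0 q"

fun bound0_conjunct :: "conjunct \<Rightarrow> var0 list" where
  "bound0_conjunct (PosLit a) = []"
| "bound0_conjunct (NegLit a) = []"
| "bound0_conjunct (CPU0 q) = bound0_pu0 q"
| "bound0_conjunct (CPU1 (All1 Zs p)) = concat (map bound0_comp1 (components p))"

fun bound1_conjunct :: "conjunct \<Rightarrow> var1 list" where
  "bound1_conjunct (PosLit a) = []"
| "bound1_conjunct (NegLit a) = []"
| "bound1_conjunct (CPU0 q) = []"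
| "bound1_conjunct (CPU1 (All1 Zs p)) = Zs"

fun free0_conjunct :: "conjunct \<Rightarrow> var0 set" where
  "free0_conjunct (PosLit a) = vars0_qf a"
| "free0_conjunct (NegLit a) = vars0_qf a"
| "free0_conjunct (CPU0 q) = free0_pu0 q"
| "free0_conjunct (CPU1 (All1 Zs p)) = (\<Union>c\<in>set (components p). free0_comp1 c)"

fun free1_conjunct :: "conjunct \<Rightarrow> var1 set" where
  "free1_conjunct (PosLit a) = vars1_qf a"
| "free1_conjunct (NegLit a) = vars1_qf a"
| "free1_conjunct (CPU0 q) = free1_pu0 q"
| "free1_conjunct (CPU1 (All1 Zs p)) = (\<Union>c\<in>set (components p). free1_comp1 c) - set Zs"

definition bound0 :: "conjunction \<Rightarrow> var0 list" where
  "bound0 \<psi> = concat (map bound0_conjunct \<psi>)"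

definition bound1 :: "conjunction \<Rightarrow> var1 list" where
  "bound1 \<psi> = concat (map bound1_conjunct \<psi>)"

definition free0 :: "conjunction \<Rightarrow> var0 set" where
  "free0 \<psi> = (\<Union>c\<in>set \<psi>. free0_conjunct c)"

definition free1 :: "conjunction \<Rightarrow> var1 set" where
  "free1 \<psi> = (\<Union>c\<in>set \<psi>. free1_conjunct c)"

text \<open>All variables occurring in a conjunction, free or bound.\<close>

definition vars0 :: "conjunction \<Rightarrow> var0 set" where
  "vars0 \<psi> = free0 \<psi> \<union> set (bound0 \<psi>)"

definition vars1 :: "conjunction \<Rightarrow> var1 set" where
  "vars1 \<psi> = free1 \<psi> \<union> set (bound1 \<psi>)"

fun enums_atom0 :: "atom0 \<Rightarrow> var0 list set" where
  "enums_atom0 (Eq0 x y) = {}"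
| "enums_atom0 (In0 x X) = {}"
| "enums_atom0 (EnumEq xs X) = {xs}"
| "enums_atom0 (EnumIn xs A) = {xs}"

fun enums_qf :: "qf_atom \<Rightarrow> var0 list set" where
  "enums_qf (Lev0 a) = enums_atom0 a"
| "enums_qf (Lev1 a) = {}"

fun enums_pu0 :: "pu0 \<Rightarrow> var0 list set" where
  "enums_pu0 (All0 zs p) = (\<Union>a\<in>set (components p). enums_atom0 a)"

fun enums_comp1 :: "comp1 \<Rightarrow> var0 list set" where
  "enums_comp1 (QF a) = enums_qf a"
| "enums_comp1 (PU0 q) = enums_pu0 q"

fun enums_conjunct :: "conjunct \<Rightarrow> var0 list set" where
  "enums_conjunct (PosLit a) = enums_qf a"
| "enums_conjunct (NegLit a) = enums_qf a"
| "enums_conjunct (CPU0 q) = enums_pu0 q"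
| "enums_conjunct (CPU1 (All1 Zs p)) = (\<Union>c\<in>set (components p). enums_comp1 c)"

definition enums :: "conjunction \<Rightarrow> var0 list set" where
  "enums \<psi> = (\<Union>c\<in>set \<psi>. enums_conjunct c)"

text \<open>Relativized interpretations are formed only for positive \<open>l\<close>, hence the requirement
  \<open>0 < l\<close>; it matters only if no enumeration occurs in \<open>\<psi>\<close>, and then \<open>l_enum \<psi> = 1\<close>.\<close>

definition l_enum :: "conjunction \<Rightarrow> nat" where
  "l_enum \<psi> = (LEAST l. 0 < l \<and> (\<forall>xs\<in>enums \<psi>. length xs \<le> l))"


subsection \<open>Simultaneous substitution of set variables\<close>

definition subst1 :: "var1 list \<Rightarrow> var1 list \<Rightarrow> var1 \<Rightarrow> var1" where
  "subst1 Zs Xs Y = (case map_of (zip Zs Xs) Y of None \<Rightarrow> Y | Some X \<Rightarrow> X)"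

fun subst_atom0 :: "var1 list \<Rightarrow> var1 list \<Rightarrow> atom0 \<Rightarrow> atom0" where
  "subst_atom0 Zs Xs (Eq0 x y) = Eq0 x y"
| "subst_atom0 Zs Xs (In0 x X) = In0 x (subst1 Zs Xs X)"
| "subst_atom0 Zs Xs (EnumEq xs X) = EnumEq xs (subst1 Zs Xs X)"
| "subst_atom0 Zs Xs (EnumIn xs A) = EnumIn xs A"

definition subst_prop0 :: "var1 list \<Rightarrow> var1 list \<Rightarrow> atom0 pform \<Rightarrow> atom0 pform" where
  "subst_prop0 Zs Xs p = map_pform (subst_atom0 Zs Xs) p"

fun subst_pu0 :: "var1 list \<Rightarrow> var1 list \<Rightarrow> pu0 \<Rightarrow> pu0" where
  "subst_pu0 Zs Xs (All0 zs p) = All0 zs (subst_prop0 Zs Xs p)"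


section \<open>Semantics\<close>

record 'd interp =
  Dom :: "'d set"
  Ind :: "var0 \<Rightarrow> 'd"
  Sets :: "var1 \<Rightarrow> 'd set"
  Colls :: "var2 \<Rightarrow> 'd set set"

definition is_interp :: "'d interp \<Rightarrow> bool" where
  "is_interp M \<longleftrightarrow> Dom M \<noteq> {} \<and> (\<forall>x. Ind M x \<in> Dom M) \<and> (\<forall>X. Sets M X \<subseteq> Dom M) \<and>
     (\<forall>A. Colls M A \<subseteq> Pow (Dom M))"

definition upd0 :: "'d interp \<Rightarrow> var0 list \<Rightarrow> 'd list \<Rightarrow> 'd interp" where
  "upd0 M zs us = M\<lparr>Ind := fold (\<lambda>(z, u) f. f(z := u)) (zip zs us) (Ind M)\<rparr>"

definition upd1 :: "'d interp \<Rightarrow> var1 list \<Rightarrow> 'd set list \<Rightarrow> 'd interp" where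
  "upd1 M Zs Us = M\<lparr>Sets := fold (\<lambda>(Z, U) f. f(Z := U)) (zip Zs Us) (Sets M)\<rparr>"

fun sat_prop :: "('a \<Rightarrow> bool) \<Rightarrow> 'a pform \<Rightarrow> bool" where
  "sat_prop s (Atom a) \<longleftrightarrow> s a"
| "sat_prop s (Neg p) \<longleftrightarrow> \<not> sat_prop s p"
| "sat_prop s (And p q) \<longleftrightarrow> sat_prop s p \<and> sat_prop s q"
| "sat_prop s (Or p q) \<longleftrightarrow> sat_prop s p \<or> sat_prop s q"
| "sat_prop s (Imp p q) \<longleftrightarrow> (sat_prop s p \<longrightarrow> sat_prop s q)"
| "sat_prop s (Iff p q) \<longleftrightarrow> (sat_prop s p \<longleftrightarrow> sat_prop s q)"

fun sat_atom0 :: "'d interp \<Rightarrow> atom0 \<Rightarrow> bool" where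
  "sat_atom0 M (Eq0 x y) \<longleftrightarrow> Ind M x = Ind M y"
| "sat_atom0 M (In0 x X) \<longleftrightarrow> Ind M x \<in> Sets M X"
| "sat_atom0 M (EnumEq xs X) \<longleftrightarrow> Ind M ` set xs = Sets M X"
| "sat_atom0 M (EnumIn xs A) \<longleftrightarrow> Ind M ` set xs \<in> Colls M A"

fun sat_atom1 :: "'d interp \<Rightarrow> atom1 \<Rightarrow> bool" where
  "sat_atom1 M (Eq1 X Y) \<longleftrightarrow> Sets M X = Sets M Y"
| "sat_atom1 M (In1 X A) \<longleftrightarrow> Sets M X \<in> Colls M A"

fun sat_qf :: "'d interp \<Rightarrow> qf_atom \<Rightarrow> bool" where
  "sat_qf M (Lev0 a) \<longleftrightarrow> sat_atom0 M a"
| "sat_qf M (Lev1 a) \<longleftrightarrow> sat_atom1 M a"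

abbreviation sat_prop0 :: "'d interp \<Rightarrow> atom0 pform \<Rightarrow> bool" where
  "sat_prop0 M \<equiv> sat_prop (sat_atom0 M)"

fun sat_pu0 :: "'d interp \<Rightarrow> pu0 \<Rightarrow> bool" where
  "sat_pu0 M (All0 zs p) \<longleftrightarrow>
     (\<forall>us. length us = length zs \<and> set us \<subseteq> Dom M \<longrightarrow> sat_prop0 (upd0 M zs us) p)"

fun sat_comp1 :: "'d interp \<Rightarrow> comp1 \<Rightarrow> bool" where
  "sat_comp1 M (QF a) \<longleftrightarrow> sat_qf M a"
| "sat_comp1 M (PU0 q) \<longleftrightarrow> sat_pu0 M q"

fun sat_pu1 :: "'d interp \<Rightarrow> pu1 \<Rightarrow> bool" where
  "sat_pu1 M (All1 Zs p) \<longleftrightarrow>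
     (\<forall>Us. length Us = length Zs \<and> set Us \<subseteq> Pow (Dom M) \<longrightarrow> sat_prop (sat_comp1 (upd1 M Zs Us)) p)"

fun sat_conjunct :: "'d interp \<Rightarrow> conjunct \<Rightarrow> bool" where
  "sat_conjunct M (PosLit a) \<longleftrightarrow> sat_qf M a"
| "sat_conjunct M (NegLit a) \<longleftrightarrow> \<not> sat_qf M a"
| "sat_conjunct M (CPU0 q) \<longleftrightarrow> sat_pu0 M q"
| "sat_conjunct M (CPU1 q) \<longleftrightarrow> sat_pu1 M q"

definition sat :: "'d interp \<Rightarrow> conjunction \<Rightarrow> bool" where
  "sat M \<psi> \<longleftrightarrow> (\<forall>c\<in>set \<psi>. sat_conjunct M c)"


section \<open>Normalized conjunctions\<close>

text \<open>\<open>linked TYPE('d) Zs ((\<forall>zs) p)\<close> is validity of the implication from \<open>\<not> p\<close> to the conjunction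
  of all \<open>z \<in> Z\<close>. As HOL cannot quantify over types, the interpretations range over all domains
  contained in the type \<open>'d\<close>. Full validity implies \<open>linked TYPE('d)\<close> for every \<open>'d\<close>, so that a
  result assuming the latter also holds under the former.\<close>

fun linked :: "'d itself \<Rightarrow> var1 list \<Rightarrow> pu0 \<Rightarrow> bool" where
  "linked _ Zs (All0 zs p) \<longleftrightarrow>
     (\<forall>M :: 'd interp. is_interp M \<longrightarrow> \<not> sat_prop0 M p \<longrightarrow>
        (\<forall>z\<in>set zs. \<forall>Z\<in>set Zs. Ind M z \<in> Sets M Z))"

fun wf_pu0 :: "pu0 \<Rightarrow> bool" where
  "wf_pu0 (All0 zs p) \<longleftrightarrow> zs \<noteq> []"

fun wf_conjunct :: "'d itself \<Rightarrow> conjunct \<Rightarrow> bool" where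
  "wf_conjunct T (PosLit a) \<longleftrightarrow> True"
| "wf_conjunct T (NegLit a) \<longleftrightarrow> True"
| "wf_conjunct T (CPU0 q) \<longleftrightarrow> wf_pu0 q"
| "wf_conjunct T (CPU1 (All1 Zs p)) \<longleftrightarrow>
     Zs \<noteq> [] \<and> (\<forall>q. PU0 q \<in> set (components p) \<longrightarrow> wf_pu0 q \<and> linked T Zs q)"

text \<open>Distinctness of \<open>bound0 \<psi>\<close> and \<open>bound1 \<psi>\<close>, which list the variables of all quantifier
  occurrences, says that no variable is bound by more than one quantifier.\<close>

definition normalized :: "'d itself \<Rightarrow> conjunction \<Rightarrow> bool" where
  "normalized T \<psi> \<longleftrightarrow>
     (\<forall>c\<in>set \<psi>. wf_conjunct T c) \<and> [] \<notin> enums \<psi> \<and>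
     distinct (bound0 \<psi>) \<and> distinct (bound1 \<psi>) \<and>
     free0 \<psi> \<inter> set (bound0 \<psi>) = {} \<and> free1 \<psi> \<inter> set (bound1 \<psi>) = {}"


section \<open>Relativized interpretations\<close>

text \<open>The cardinality \<open>card\<close> of an infinite set is \<open>0\<close>; \<open>ecard\<close> makes it infinite.\<close>

definition ecard :: "'a set \<Rightarrow> enat" where
  "ecard S = (if finite S then enat (card S) else \<infinity>)"

definition pow_le :: "nat \<Rightarrow> 'a set \<Rightarrow> 'a set set" where
  "pow_le l S = {T. T \<subseteq> S \<and> ecard T \<le> enat l}"

definition rel_ind :: "'d interp \<Rightarrow> 'd set \<Rightarrow> 'd \<Rightarrow> var0 \<Rightarrow> 'd" where
  "rel_ind M Ds d x = (if Ind M x \<in> Ds then Ind M x else d)"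

definition rel_set :: "'d interp \<Rightarrow> 'd set \<Rightarrow> var1 \<Rightarrow> 'd set" where
  "rel_set M Ds X = Sets M X \<inter> Ds"

definition rel_coll ::
  "'d interp \<Rightarrow> 'd set \<Rightarrow> 'd \<Rightarrow> var0 set \<Rightarrow> var1 set \<Rightarrow> nat \<Rightarrow> var2 \<Rightarrow> 'd set set" where
  "rel_coll M Ds d V0 V1 l A =
     (let S = rel_ind M Ds d ` V0 in
        ((Colls M A \<inter> Pow Ds) - (rel_set M Ds ` V1 \<union> pow_le l S))
        \<union> {rel_set M Ds X | X. X \<in> V1 \<and> Sets M X \<in> Colls M A}
        \<union> (pow_le l S \<inter> Colls M A))"

definition Rel ::
  "'d interp \<Rightarrow> 'd set \<Rightarrow> 'd \<Rightarrow> var0 set \<Rightarrow> var1 set \<Rightarrow> nat \<Rightarrow> 'd interp" where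
  "Rel M Ds d V0 V1 l =
     \<lparr>Dom = Ds, Ind = rel_ind M Ds d, Sets = rel_set M Ds, Colls = rel_coll M Ds d V0 V1 l\<rparr>"


section \<open>Witnesses for falsified instances\<close>

text \<open>The purely universal level-0 components of the purely universal level-1 conjuncts of
  \<open>\<psi>\<close>, each paired with its list of arguments.\<close>

definition Phi :: "conjunction \<Rightarrow> (var1 list \<times> pu0) set" where
  "Phi \<psi> = {(Zs, q) | Zs p q. CPU1 (All1 Zs p) \<in> set \<psi> \<and> PU0 q \<in> set (components p)}"

definition false_instances ::
  "'d interp \<Rightarrow> conjunction \<Rightarrow> (var1 list \<times> pu0 \<times> var1 list) set" where
  "false_instances M \<psi> = {(Zs, q, Xs). (Zs, q) \<in> Phi \<psi> \<and> length Xs = length Zs \<and>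
     set Xs \<subseteq> vars1 \<psi> \<and> \<not> sat_pu0 M (subst_pu0 Zs Xs q)}"

fun is_witness :: "'d interp \<Rightarrow> var1 list \<times> pu0 \<times> var1 list \<Rightarrow> 'd list \<Rightarrow> bool" where
  "is_witness M (Zs, All0 zs p, Xs) us \<longleftrightarrow>
     length us = length zs \<and> set us \<subseteq> Dom M \<and> \<not> sat_prop0 (upd0 M zs us) (subst_prop0 Zs Xs p)"

end

theory Submission imports Defs begin

text \<open>A subset \<open>U\<close> of \<open>D\<^sup>*\<close> is lifted back to \<open>M X\<close> if it has the form \<open>M\<^sup>* X\<close> for an \<open>X\<close>
  occurring in \<open>\<psi>\<close>, and to itself otherwise. The set \<open>D\<^sub>0\<close> makes lifting well defined, and \<open>D\<^sub>1\<close>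
  makes it the identity on sets of at most \<open>l\<^sub>\<psi>\<close> elements; hence all atoms have the same truth value
  before and after lifting, as long as individuals stay in \<open>D\<^sup>*\<close>. Only a level-0 component that
  the lifted interpretation falsifies by individuals outside \<open>D\<^sup>*\<close> could change its value. By
  linkedness these individuals lie in all lifted arguments, so that every argument has been lifted
  to some \<open>M X\<close>; the component is then a false instance, for which \<open>D\<^sup>*\<close> contains witnesses.\<close>

section \<open>Propositional combinations, updates and substitution\<close>

lemma sat_prop_cong:
  "(\<And>a. a \<in> set (components p) \<Longrightarrow> s a = t a) \<Longrightarrow> sat_prop s p = sat_prop t p"
  by (induction p) auto

lemma sat_prop_map: "sat_prop s (map_pform f p) = sat_prop (\<lambda>a. s (f a)) p"
  by (induction p) auto

lemma map_of_zip_notin: "length us = length zs \<Longrightarrow> x \<notin> set zs \<Longrightarrow> map_of (zip zs us) x = None"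
  by (simp add: map_of_zip_is_None)

text \<open>\<open>fold\<close> lets the last pair for a variable win, \<open>map_of\<close> the
  first; distinctness of the variables reconciles the two.\<close>

lemma fold_upd_zip:
  assumes "length us = length zs" "distinct zs"
  shows "fold (\<lambda>(z, u) f. f(z := u)) (zip zs us) f x
    = (case map_of (zip zs us) x of None \<Rightarrow> f x | Some u \<Rightarrow> u)"
  using assms
proof (induction us zs arbitrary: f rule: list_induct2)
  case (Cons u us z zs)
  have "fold (\<lambda>(z, u) f. f(z := u)) (zip (z # zs) (u # us)) f x
      = fold (\<lambda>(z, u) f. f(z := u)) (zip zs us) (f(z := u)) x"
    by (simp only: zip_Cons_Cons fold_simps prod.case)
  also have "\<dots> = (case map_of (zip zs us) x of None \<Rightarrow> (f(z := u)) x | Some u \<Rightarrow> u)"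
    using Cons.prems by (intro Cons.IH) simp
  also have "\<dots> = (case map_of (zip (z # zs) (u # us)) x of None \<Rightarrow> f x | Some u \<Rightarrow> u)"
    using Cons by (cases "x = z") (simp_all add: map_of_zip_notin split: option.split)
  finally show ?case .
qed simp

section \<open>Values of updated interpretations\<close>

lemma upd0_simps [simp]:
  "Dom (upd0 M zs us) = Dom M" "Sets (upd0 M zs us) = Sets M" "Colls (upd0 M zs us) = Colls M"
  by (simp_all add: upd0_def)

lemma upd1_simps [simp]:
  "Dom (upd1 M Zs Us) = Dom M" "Ind (upd1 M Zs Us) = Ind M" "Colls (upd1 M Zs Us) = Colls M"
  by (simp_all add: upd1_def)

lemma Rel_simps [simp]:
  "Dom (Rel M Ds d V0 V1 l) = Ds" "Ind (Rel M Ds d V0 V1 l) = rel_ind M Ds d"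
  "Sets (Rel M Ds d V0 V1 l) = rel_set M Ds" "Colls (Rel M Ds d V0 V1 l) = rel_coll M Ds d V0 V1 l"
  by (simp_all add: Rel_def)

lemma Ind_upd0:
  "length us = length zs \<Longrightarrow> distinct zs \<Longrightarrow>
    Ind (upd0 M zs us) x = (case map_of (zip zs us) x of None \<Rightarrow> Ind M x | Some u \<Rightarrow> u)"
  by (simp add: upd0_def fold_upd_zip)

lemma Sets_upd1:
  "length Us = length Zs \<Longrightarrow> distinct Zs \<Longrightarrow>
    Sets (upd1 M Zs Us) X = (case map_of (zip Zs Us) X of None \<Rightarrow> Sets M X | Some U \<Rightarrow> U)"
  by (simp add: upd1_def fold_upd_zip)

lemma map_of_zip_nth_Some:
  assumes "length us = length zs" "distinct zs" "x \<in> set zs"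
  obtains i where "i < length zs" "zs ! i = x" "map_of (zip zs us) x = Some (us ! i)"
  by (metis assms in_set_conv_nth map_of_zip_nth)

lemma Ind_upd0_in:
  assumes "length us = length zs" "distinct zs" "x \<in> set zs"
  shows "Ind (upd0 M zs us) x \<in> set us"
proof -
  obtain i where "i < length zs" "map_of (zip zs us) x = Some (us ! i)"
    using assms by (rule map_of_zip_nth_Some)
  then show ?thesis using assms by (simp add: Ind_upd0)
qed

text \<open>Turns a statement about the values of the quantified variables, as linkedness provides
  it, into one about the assigned individuals.\<close>

lemma set_subset_upd0:
  assumes "length us = length zs" "distinct zs"
  shows "set us \<subseteq> Ind (upd0 M zs us) ` set zs"
proof
  fix u assume "u \<in> set us"
  then obtain i where i: "i < length zs" "u = us ! i" using assms by (metis in_set_conv_nth)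
  then have "Ind (upd0 M zs us) (zs ! i) = u" using assms by (simp add: Ind_upd0 map_of_zip_nth)
  then show "u \<in> Ind (upd0 M zs us) ` set zs" using i by (metis image_eqI nth_mem)
qed

lemma is_interp_upd0:
  assumes "is_interp M" "length us = length zs" "distinct zs" "set us \<subseteq> Dom M"
  shows "is_interp (upd0 M zs us)"
proof -
  have "Ind (upd0 M zs us) x \<in> Dom M" for x
    using assms Ind_upd0_in[OF assms(2,3), of x M]
    by (cases "x \<in> set zs") (auto simp: Ind_upd0 map_of_zip_notin is_interp_def)
  then show ?thesis using assms(1) by (simp add: is_interp_def)
qed

lemma is_interp_upd1:
  assumes "is_interp M" "length Us = length Zs" "distinct Zs" "set Us \<subseteq> Pow (Dom M)"
  shows "is_interp (upd1 M Zs Us)"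
proof -
  have "Sets (upd1 M Zs Us) X \<subseteq> Dom M" for X
  proof (cases "X \<in> set Zs")
    case True
    then obtain i where "i < length Zs" "map_of (zip Zs Us) X = Some (Us ! i)"
      using assms(2,3) by (blast elim: map_of_zip_nth_Some)
    then show ?thesis using assms(2,3,4) by (force simp: Sets_upd1)
  next
    case False
    then show ?thesis using assms by (simp add: Sets_upd1 map_of_zip_notin is_interp_def)
  qed
  then show ?thesis using assms(1) by (simp add: is_interp_def)
qed

section \<open>Substitution of set variables as an update\<close>

lemma Sets_upd1_subst:
  assumes "length Xs = length Zs" "distinct Zs"
  shows "Sets (upd1 M Zs (map (Sets M) Xs)) Y = Sets M (subst1 Zs Xs Y)"
proof -
  have "map_of (zip Zs (map (Sets M) Xs)) Y = map_option (Sets M) (map_of (zip Zs Xs) Y)"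
    by (simp add: zip_map2 map_of_map)
  then show ?thesis using assms
    by (cases "map_of (zip Zs Xs) Y")
      (simp_all add: Sets_upd1 subst1_def del: map_of_zip_is_None)
qed

lemma sat_atom0_subst:
  assumes "length Xs = length Zs" "distinct Zs"
  shows "sat_atom0 (upd0 M zs us) (subst_atom0 Zs Xs a)
    = sat_atom0 (upd0 (upd1 M Zs (map (Sets M) Xs)) zs us) a"
proof -
  have "Ind (upd0 (upd1 M Zs (map (Sets M) Xs)) zs us) = Ind (upd0 M zs us)"
    by (simp add: upd0_def)
  then show ?thesis using assms by (cases a) (simp_all add: Sets_upd1_subst)
qed

lemma sat_prop0_subst:
  assumes "length Xs = length Zs" "distinct Zs"
  shows "sat_prop0 (upd0 M zs us) (subst_prop0 Zs Xs p)
    = sat_prop0 (upd0 (upd1 M Zs (map (Sets M) Xs)) zs us) p"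
  by (simp add: subst_prop0_def sat_prop_map sat_atom0_subst[OF assms])

text \<open>No capture can occur: the quantifiers bind individual variables, while the substitution
  renames set variables.\<close>

lemma sat_pu0_subst:
  assumes "length Xs = length Zs" "distinct Zs"
  shows "sat_pu0 M (subst_pu0 Zs Xs q) = sat_pu0 (upd1 M Zs (map (Sets M) Xs)) q"
  by (cases q) (simp add: sat_prop0_subst[OF assms])

section \<open>Cardinalities and enumerations\<close>

lemma ecard_mono: "A \<subseteq> B \<Longrightarrow> ecard A \<le> ecard B"
  by (auto simp: ecard_def card_mono dest: finite_subset)

lemma ecard_image_set_le: "ecard (f ` set xs) \<le> enat (length xs)"
  using card_image_le[of "set xs" f] card_length[of xs] by (simp add: ecard_def)

text \<open>The bound \<open>l\<close> rules out \<open>l + 1\<close> as the minimum, so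
  \<open>ecard A\<close> itself is at most the size of the part inside \<open>B\<close>; a finite
  set has no proper part of its own size.\<close>

lemma subset_of_ecard_min_le:
  assumes "min (enat (l + 1)) (ecard A) \<le> ecard (A \<inter> B)" and "ecard (A \<inter> B) \<le> enat l"
  shows "A \<subseteq> B"
proof -
  have fin: "finite (A \<inter> B)" "card (A \<inter> B) \<le> l"
    using assms(2) by (auto simp: ecard_def split: if_splits)
  then have "finite A \<and> card A \<le> card (A \<inter> B)"
    using assms(1) by (auto simp: ecard_def min_def split: if_splits)
  then have "A \<inter> B = A" by (intro card_seteq) auto
  then show ?thesis by blast
qed

lemma finite_enums: "finite (enums \<psi>)"
proof -
  have a: "finite (enums_atom0 a)" for a by (cases a) auto
  have q: "finite (enums_qf a)" for a by (cases a) (auto simp: a)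
  have p: "finite (enums_pu0 r)" for r by (cases r) (auto simp: a)
  have c: "finite (enums_comp1 c)" for c by (cases c) (auto simp: q p)
  have "finite (enums_conjunct c)" for c
    by (cases c rule: enums_conjunct.cases) (auto simp: q p c)
  then show ?thesis by (simp add: enums_def)
qed

lemma length_le_l_enum:
  assumes "xs \<in> enums \<psi>"
  shows "length xs \<le> l_enum \<psi>"
proof -
  \<comment> \<open>The successor keeps the bound positive; without enumerations the value of
    \<open>Max\<close> is irrelevant, as the second conjunct is vacuous.\<close>
  have "0 < Suc (Max (length ` enums \<psi>)) \<and> (\<forall>xs\<in>enums \<psi>. length xs \<le> Suc (Max (length ` enums \<psi>)))"
    using finite_enums[of \<psi>] by (simp add: le_SucI)
  then have "0 < l_enum \<psi> \<and> (\<forall>xs\<in>enums \<psi>. length xs \<le> l_enum \<psi>)"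
    unfolding l_enum_def by (rule LeastI)
  then show ?thesis using assms by blast
qed

section \<open>Lifting sets from the relativized interpretation\<close>

text \<open>The assumptions keep only what \<open>D0\<close> (\<open>sep\<close>) and
  \<open>D1\<close> (\<open>small\<close>) contribute; the inclusion of \<open>Ds\<close> in the
  domain and the witnesses enter as premises where they are needed.\<close>

locale relativization =
  fixes M :: "'d interp" and Ds :: "'d set" and d :: 'd
    and V0 :: "var0 set" and V1 :: "var1 set" and l :: nat
  assumes sep: "\<And>X Y. X \<in> V1 \<Longrightarrow> Y \<in> V1 \<Longrightarrow> rel_set M Ds X = rel_set M Ds Y \<Longrightarrow> Sets M X = Sets M Y"
    and small: "\<And>X. X \<in> V1 \<Longrightarrow> ecard (rel_set M Ds X) \<le> enat l \<Longrightarrow> Sets M X = rel_set M Ds X"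
begin

abbreviation "RM \<equiv> Rel M Ds d V0 V1 l"

text \<open>A relation, so that no name has to be chosen for a set. Excluding named sets from the
  second case lets \<open>U'\<close> determine \<open>U\<close>, given \<open>sep\<close>.\<close>

definition lifts :: "'d set \<Rightarrow> 'd set \<Rightarrow> bool" where
  "lifts U U' \<longleftrightarrow> (\<exists>X\<in>V1. U = Sets M X \<and> U' = rel_set M Ds X)
     \<or> (U = U' \<and> U' \<subseteq> Ds \<and> U' \<notin> rel_set M Ds ` V1)"

lemma lifts_var: "X \<in> V1 \<Longrightarrow> lifts (Sets M X) (rel_set M Ds X)"
  by (auto simp: lifts_def)

lemma lifts_inter: "lifts U U' \<Longrightarrow> U' = U \<inter> Ds"
  by (auto simp: lifts_def rel_set_def)

text \<open>Intersecting with \<open>Ds\<close> recovers \<open>U'\<close> from \<open>U\<close>.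
  Conversely, equal named sets have equal lifts by \<open>sep\<close>, and unnamed ones are their
  own lifts.\<close>

lemma lifts_eq_iff:
  assumes "lifts U U'" "lifts W W'"
  shows "U' = W' \<longleftrightarrow> U = W"
proof
  assume eq: "U' = W'"
  show "U = W"
  proof (cases "U' \<in> rel_set M Ds ` V1")
    case True
    then obtain X Y where "X \<in> V1" "U = Sets M X" "U' = rel_set M Ds X"
      "Y \<in> V1" "W = Sets M Y" "W' = rel_set M Ds Y"
      using assms eq by (auto simp: lifts_def)
    then show ?thesis using sep[of X Y] eq by simp
  next
    case False
    then show ?thesis using assms eq by (auto simp: lifts_def)
  qed
next
  show "U' = W'" if "U = W" using that assms[THEN lifts_inter] by simp
qed

lemma lifts_coll_iff:
  assumes "lifts U U'"
  shows "U' \<in> rel_coll M Ds d V0 V1 l A \<longleftrightarrow> U \<in> Colls M A"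
proof (cases "U' \<in> rel_set M Ds ` V1")
  case True
  then obtain X where X: "X \<in> V1" "U = Sets M X" "U' = rel_set M Ds X"
    using assms by (auto simp: lifts_def)
  \<comment> \<open>The third part of \<open>rel_coll\<close> tests the restricted set itself; by
    \<open>small\<close> this set is \<open>Sets M X\<close>, so the test agrees with that of the
    second part. The first part contains no named set.\<close>
  have "Sets M X = rel_set M Ds X" if "rel_set M Ds X \<in> pow_le l S" for S
    using that small[OF X(1)] by (simp add: pow_le_def)
  then have "U' \<in> rel_coll M Ds d V0 V1 l A
      \<longleftrightarrow> (\<exists>Y\<in>V1. rel_set M Ds X = rel_set M Ds Y \<and> Sets M Y \<in> Colls M A)"
    using X by (auto simp: rel_coll_def Let_def)
  also have "\<dots> \<longleftrightarrow> U \<in> Colls M A"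
    using X sep by metis
  finally show ?thesis .
next
  case False
  \<comment> \<open>An unnamed set is its own lift and cannot come from the second part; whether or
    not it lies in \<open>pow_le l S\<close>, the remaining parts ask exactly for membership in
    \<open>Colls M A\<close>.\<close>
  then show ?thesis using assms by (auto simp: lifts_def rel_coll_def Let_def)
qed

lemma lifts_self:
  assumes "T \<subseteq> Ds" "ecard T \<le> enat l"
  shows "lifts T T"
  using assms small by (fastforce simp: lifts_def)

section \<open>Corresponding interpretations and their truth values\<close>

text \<open>\<open>N'\<close> is the relativized side. Only variables in \<open>V\<close> and
  \<open>W\<close> are constrained, since elsewhere \<open>rel_ind\<close> may return
  \<open>d\<close> and sets need not be related by \<open>lifts\<close>. Collections are never
  updated, so their values are fixed.\<close>

definition corr :: "'d interp \<Rightarrow> 'd interp \<Rightarrow> var0 set \<Rightarrow> var1 set \<Rightarrow> bool" where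
  "corr N N' V W \<longleftrightarrow> (\<forall>x\<in>V. Ind N' x = Ind N x \<and> Ind N x \<in> Ds)
     \<and> (\<forall>X\<in>W. lifts (Sets N X) (Sets N' X))
     \<and> Colls N = Colls M \<and> Colls N' = rel_coll M Ds d V0 V1 l"

lemma corr_mono: "corr N N' V W \<Longrightarrow> V' \<subseteq> V \<Longrightarrow> W' \<subseteq> W \<Longrightarrow> corr N N' V' W'"
  by (auto simp: corr_def)

text \<open>An enumeration denotes the same set on both sides, and that set, having at most
  \<open>l\<close> elements, all in \<open>Ds\<close>, lifts to itself; so the facts about
  \<open>lifts\<close> apply to it as to the value of a set variable.\<close>

lemma corr_atom0:
  assumes "corr N N' (vars0_atom0 a) (vars1_atom0 a)"
    and "\<And>xs. xs \<in> enums_atom0 a \<Longrightarrow> length xs \<le> l"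
  shows "sat_atom0 N' a = sat_atom0 N a"
proof -
  have img: "Ind N' ` set xs = Ind N ` set xs" "Ind N ` set xs \<subseteq> Ds" "ecard (Ind N ` set xs) \<le> enat l"
    if "set xs \<subseteq> vars0_atom0 a" "xs \<in> enums_atom0 a" for xs
  proof -
    show "Ind N' ` set xs = Ind N ` set xs" "Ind N ` set xs \<subseteq> Ds"
      using assms(1) that(1) by (force simp: corr_def)+
    have "enat (length xs) \<le> enat l" using assms(2) that(2) by simp
    then show "ecard (Ind N ` set xs) \<le> enat l"
      using ecard_image_set_le order_trans by blast
  qed
  show ?thesis
  proof (cases a)
    case (Eq0 x y)
    then show ?thesis using assms(1) by (simp add: corr_def)
  next
    case (In0 x X)
    then show ?thesis using assms(1) lifts_inter[of "Sets N X" "Sets N' X"] by (auto simp: corr_def)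
  next
    case (EnumEq xs X)
    then have "lifts (Sets N X) (Sets N' X)" using assms(1) by (simp add: corr_def)
    moreover have "lifts (Ind N ` set xs) (Ind N' ` set xs)"
      using EnumEq img[of xs] lifts_self by simp
    ultimately show ?thesis using EnumEq lifts_eq_iff by simp
  next
    case (EnumIn xs A)
    then have "lifts (Ind N ` set xs) (Ind N' ` set xs)" using img[of xs] lifts_self by simp
    then show ?thesis using EnumIn assms(1) lifts_coll_iff by (simp add: corr_def)
  qed
qed

lemma corr_qf:
  assumes "corr N N' (vars0_qf a) (vars1_qf a)"
    and "\<And>xs. xs \<in> enums_qf a \<Longrightarrow> length xs \<le> l"
  shows "sat_qf N' a = sat_qf N a"
proof (cases a)
  case (Lev0 b)
  then show ?thesis using assms corr_atom0 by simp
next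
  case (Lev1 b)
  then show ?thesis using assms(1) by (cases b) (auto simp: corr_def lifts_eq_iff lifts_coll_iff)
qed

lemma corr_upd0:
  assumes "corr N N' (V - set zs) W" "length us = length zs" "distinct zs" "set us \<subseteq> Ds"
  shows "corr (upd0 N zs us) (upd0 N' zs us) V W"
proof -
  have "Ind (upd0 N' zs us) x = Ind (upd0 N zs us) x \<and> Ind (upd0 N zs us) x \<in> Ds" if "x \<in> V" for x
  proof (cases "x \<in> set zs")
    case True
    then have "Ind (upd0 N' zs us) x = Ind (upd0 N zs us) x"
      using assms(2,3) by (auto simp: Ind_upd0 elim!: map_of_zip_nth_Some)
    then show ?thesis using Ind_upd0_in[OF assms(2,3) True] assms(4) by auto
  next
    case False
    then show ?thesis using assms that by (simp add: Ind_upd0 map_of_zip_notin corr_def)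
  qed
  then show ?thesis using assms(1) by (simp add: corr_def)
qed

lemma corr_prop0_upd0:
  assumes "corr N N' (free0_pu0 (All0 zs p)) (free1_pu0 (All0 zs p))"
    and "\<And>xs. xs \<in> enums_pu0 (All0 zs p) \<Longrightarrow> length xs \<le> l"
    and "length us = length zs" "distinct zs" "set us \<subseteq> Ds"
  shows "sat_prop0 (upd0 N' zs us) p = sat_prop0 (upd0 N zs us) p"
proof (rule sat_prop_cong)
  fix a assume a: "a \<in> set (components p)"
  have "corr (upd0 N zs us) (upd0 N' zs us) (vars0_atom0 a) (vars1_atom0 a)"
    by (rule corr_mono[OF corr_upd0]) (use assms a in auto)
  then show "sat_atom0 (upd0 N' zs us) a = sat_atom0 (upd0 N zs us) a"
    using corr_atom0 assms(2) a by force
qed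

text \<open>Universal formulae survive the passage to fewer individuals. The converse fails in
  general and is what the witnesses are for.\<close>

lemma corr_pu0:
  assumes "corr N N' (free0_pu0 q) (free1_pu0 q)"
    and "\<And>xs. xs \<in> enums_pu0 q \<Longrightarrow> length xs \<le> l"
    and "distinct (bound0_pu0 q)" "Dom N' = Ds" "Ds \<subseteq> Dom N" "sat_pu0 N q"
  shows "sat_pu0 N' q"
proof (cases q)
  case (All0 zs p)
  show ?thesis unfolding All0 sat_pu0.simps
  proof (intro allI impI, elim conjE)
    fix us assume us: "length us = length zs" "set us \<subseteq> Dom N'"
    then have "sat_prop0 (upd0 N' zs us) p = sat_prop0 (upd0 N zs us) p"
      using assms All0 by (intro corr_prop0_upd0) auto
    then show "sat_prop0 (upd0 N' zs us) p" using us assms All0 by auto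
  qed
qed

lemma corr_Rel:
  assumes "Ind M ` V \<subseteq> Ds" "W \<subseteq> V1"
  shows "corr M RM V W"
  using assms by (auto simp: corr_def lifts_var rel_ind_def)

section \<open>A canonical lift and the components of level-1 formulae\<close>

definition name_of :: "'d set \<Rightarrow> var1" where
  "name_of U = (SOME X. X \<in> V1 \<and> U = rel_set M Ds X)"

text \<open>By \<open>sep\<close> all names of a set have the same value under \<open>M\<close>, so
  the choice made by \<open>name_of\<close> does not matter.\<close>

definition lift :: "'d set \<Rightarrow> 'd set" where
  "lift U = (if U \<in> rel_set M Ds ` V1 then Sets M (name_of U) else U)"

lemma name_of: "U \<in> rel_set M Ds ` V1 \<Longrightarrow> name_of U \<in> V1 \<and> U = rel_set M Ds (name_of U)"
  unfolding name_of_def by (rule someI_ex) auto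

lemma lifts_lift: "U \<subseteq> Ds \<Longrightarrow> lifts (lift U) U"
  using name_of by (auto simp: lifts_def lift_def)

text \<open>Matches any assignment of subsets of \<open>Ds\<close> with one for \<open>M\<close>, to
  which satisfaction by \<open>M\<close> can be applied.\<close>

lemma corr_upd1:
  assumes "Ind M ` V \<subseteq> Ds" "W - set Zs \<subseteq> V1"
    and "length Us = length Zs" "distinct Zs" "set Us \<subseteq> Pow Ds"
  shows "corr (upd1 M Zs (map lift Us)) (upd1 RM Zs Us) V W"
proof -
  have "lifts (Sets (upd1 M Zs (map lift Us)) X) (Sets (upd1 RM Zs Us) X)" if "X \<in> W" for X
  proof (cases "X \<in> set Zs")
    case True
    then obtain i where i: "i < length Zs" "Zs ! i = X"
      by (auto simp: in_set_conv_nth)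
    then have "Us ! i \<subseteq> Ds" using assms(3,5) by force
    then show ?thesis using i assms(3,4) lifts_lift by (auto simp: Sets_upd1 map_of_zip_nth)
  next
    case False
    then show ?thesis using assms that by (auto simp: Sets_upd1 map_of_zip_notin lifts_var)
  qed
  then show ?thesis using assms(1) by (auto simp: corr_def rel_ind_def)
qed

lemma corr_comp1:
  assumes interp: "is_interp M" and Ds: "Ds \<subseteq> Dom M"
    and free: "Ind M ` free0_comp1 c \<subseteq> Ds" "free1_comp1 c - set Zs \<subseteq> V1"
    and enums: "\<And>xs. xs \<in> enums_comp1 c \<Longrightarrow> length xs \<le> l"
    and dist: "distinct (bound0_comp1 c)"
    and linked: "\<And>q. c = PU0 q \<Longrightarrow> linked TYPE('d) Zs q"
    and witness: "\<And>zs p Xs. c = PU0 (All0 zs p) \<Longrightarrow> length Xs = length Zs \<Longrightarrow> set Xs \<subseteq> V1 \<Longrightarrow>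
      \<not> sat_pu0 M (subst_pu0 Zs Xs (All0 zs p)) \<Longrightarrow>
      \<exists>us. is_witness M (Zs, All0 zs p, Xs) us \<and> set us \<subseteq> Ds"
    and Us: "length Us = length Zs" "distinct Zs" "set Us \<subseteq> Pow Ds"
  shows "sat_comp1 (upd1 RM Zs Us) c = sat_comp1 (upd1 M Zs (map lift Us)) c"
proof -
  let ?N = "upd1 M Zs (map lift Us)" and ?N' = "upd1 RM Zs Us"
  have corr: "corr ?N ?N' (free0_comp1 c) (free1_comp1 c)"
    using free Us by (rule corr_upd1)
  show ?thesis
  proof (cases c)
    case (QF a)
    then show ?thesis using corr corr_qf enums by simp
  next
    case (PU0 q)
    obtain zs p where q: "q = All0 zs p" by (cases q)
    have same: "sat_prop0 (upd0 ?N' zs us) p = sat_prop0 (upd0 ?N zs us) p"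
      if "length us = length zs" "set us \<subseteq> Ds" for us
      using that corr enums dist PU0 q by (intro corr_prop0_upd0) auto
    have "sat_pu0 ?N' q" if "sat_pu0 ?N q"
      by (rule corr_pu0[of ?N]) (use that corr enums dist PU0 Ds in auto)
    moreover have "\<not> sat_pu0 ?N' q" if false: "\<not> sat_pu0 ?N q"
    proof -
      \<comment> \<open>By \<open>same\<close>, falsifying individuals from \<open>Ds\<close> also
        falsify the component on the relativized side.\<close>
      have "\<exists>us. length us = length zs \<and> set us \<subseteq> Ds \<and> \<not> sat_prop0 (upd0 ?N zs us) p"
      proof (cases "set Us \<subseteq> rel_set M Ds ` V1")
        case True
        \<comment> \<open>When every argument has a name, the lifted assignment is the one induced
          by substituting these names.\<close>
        define Xs where "Xs = map name_of Us"
        have Xs: "length Xs = length Zs" "set Xs \<subseteq> V1"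
          using True name_of Us(1) by (auto simp: Xs_def)
        have "map lift Us = map (Sets M) Xs"
          using True by (auto simp: Xs_def lift_def)
        then have "\<not> sat_pu0 M (subst_pu0 Zs Xs q)"
          and w: "\<And>us. sat_prop0 (upd0 M zs us) (subst_prop0 Zs Xs p) = sat_prop0 (upd0 ?N zs us) p"
          using false Xs Us by (simp_all add: sat_pu0_subst sat_prop0_subst)
        then obtain us where "is_witness M (Zs, All0 zs p, Xs) us" "set us \<subseteq> Ds"
          using witness[of zs p Xs] PU0 q Xs by blast
        then show ?thesis using w by auto
      next
        case False
        \<comment> \<open>An argument without a name is its own lift, hence a subset of
          \<open>Ds\<close>; linkedness will force any falsifying individuals into it.\<close>
        then obtain j where j: "j < length Zs" "Us ! j \<notin> rel_set M Ds ` V1"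
          using Us(1) by (auto simp: subset_iff in_set_conv_nth)
        obtain us where us: "length us = length zs" "set us \<subseteq> Dom M" "\<not> sat_prop0 (upd0 ?N zs us) p"
          using false q by auto
        \<comment> \<open>Linkedness speaks of genuine interpretations only, so the lifted sets must
          stay within the domain.\<close>
        have "set (map lift Us) \<subseteq> Pow (Dom M)"
          using interp Us(3) Ds by (auto simp: lift_def is_interp_def)
        then have "is_interp (upd0 ?N zs us)"
          using interp us Us dist PU0 q by (intro is_interp_upd0 is_interp_upd1) auto
        then have "\<forall>z\<in>set zs. Ind (upd0 ?N zs us) z \<in> Sets ?N (Zs ! j)"
          using linked[OF PU0] q us(3) nth_mem[OF j(1)] by fastforce
        moreover have "Sets ?N (Zs ! j) = Us ! j"
          using j Us by (simp add: Sets_upd1 map_of_zip_nth lift_def)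
        moreover have "Us ! j \<subseteq> Ds" using j Us by force
        ultimately have "set us \<subseteq> Ds"
          using set_subset_upd0[OF us(1), of ?N] dist PU0 q by fastforce
        then show ?thesis using us by blast
      qed
      then show ?thesis using same q by auto
    qed
    ultimately show ?thesis using PU0 by auto
  qed
qed

end

section \<open>Relativization to the constructed domain\<close>

theorem theorem4p2:
  fixes M :: "'d interp" and \<psi> :: conjunction
    and D0 D1 Ds :: "'d set" and d :: 'd
    and w :: "var1 list \<times> pu0 \<times> var1 list \<Rightarrow> 'd list"
  assumes "normalized TYPE('d) \<psi>"
    and "is_interp M" and "sat M \<psi>"
    and "D0 \<subseteq> Dom M"
    and "\<And>X Y. X \<in> vars1 \<psi> \<Longrightarrow> Y \<in> vars1 \<psi> \<Longrightarrow> Sets M X \<noteq> Sets M Y \<Longrightarrow>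
           Sets M X \<inter> D0 \<noteq> Sets M Y \<inter> D0"
    and "finite D0" and "card D0 \<le> card (vars1 \<psi>) - 1"
    and "D1 \<subseteq> Dom M"
    and "\<And>X. X \<in> vars1 \<psi> \<Longrightarrow>
           ecard (Sets M X \<inter> D1) \<ge> min (enat (l_enum \<psi> + 1)) (ecard (Sets M X))"
    and "\<And>i. i \<in> false_instances M \<psi> \<Longrightarrow> is_witness M i (w i)"
    and "Ds = Ind M ` vars0 \<psi> \<union> D0 \<union> D1 \<union> (\<Union>i\<in>false_instances M \<psi>. set (w i))"
    and "d \<in> Ds"
  shows "sat (Rel M Ds d (vars0 \<psi>) (vars1 \<psi>) (l_enum \<psi>)) \<psi>"
proof -
  let ?V0 = "vars0 \<psi>" and ?V1 = "vars1 \<psi>" and ?l = "l_enum \<psi>"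
  note norm = assms(1) and interp = assms(2) and model = assms(3) and sep = assms(5)
    and small = assms(9) and wit = assms(10) and Ds_def = assms(11)
  have DsM: "Ds \<subseteq> Dom M"
  proof -
    have "set (w i) \<subseteq> Dom M" if "i \<in> false_instances M \<psi>" for i
      \<comment> \<open>The case rule exposes the triple and its quantifier prefix, so that
        \<open>is_witness\<close> unfolds.\<close>
      using wit[OF that] by (cases "(M, i, w i)" rule: is_witness.cases) auto
    then show ?thesis using interp assms(4,8) by (auto simp: Ds_def is_interp_def)
  qed
  interpret relativization M Ds d ?V0 ?V1 ?l
  proof
    fix X Y assume "X \<in> ?V1" "Y \<in> ?V1" "rel_set M Ds X = rel_set M Ds Y"
    then show "Sets M X = Sets M Y" using sep[of X Y] by (auto simp: Ds_def rel_set_def)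
  next
    fix X assume X: "X \<in> ?V1" "ecard (rel_set M Ds X) \<le> enat ?l"
    \<comment> \<open>\<open>Sets M X\<close> has too few elements in \<open>D1\<close> to reach
      \<open>l_enum \<psi> + 1\<close>, so \<open>D1\<close> must contain all of it.\<close>
    have "Sets M X \<inter> D1 \<subseteq> rel_set M Ds X" by (auto simp: Ds_def rel_set_def)
    then have "ecard (Sets M X \<inter> D1) \<le> enat ?l" using X(2) ecard_mono order_trans by blast
    then have "Sets M X \<subseteq> D1" using small[OF X(1)] subset_of_ecard_min_le by blast
    then show "Sets M X = rel_set M Ds X" by (auto simp: Ds_def rel_set_def)
  qed
  have V0: "Ind M ` ?V0 \<subseteq> Ds" by (auto simp: Ds_def)
  show ?thesis unfolding sat_def
  proof
    fix c assume c: "c \<in> set \<psi>"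
    have satc: "sat_conjunct M c" using model c by (simp add: sat_def)
    have free0: "free0_conjunct c \<subseteq> ?V0" and free1: "free1_conjunct c \<subseteq> ?V1"
      using c by (auto simp: vars0_def vars1_def free0_def free1_def)
    have enums: "length xs \<le> ?l" if "xs \<in> enums_conjunct c" for xs
      using that c length_le_l_enum by (auto simp: enums_def)
    have dist: "distinct (bound0_conjunct c)" "distinct (bound1_conjunct c)"
      using norm c by (auto simp: normalized_def bound0_def bound1_def distinct_concat_iff)
    have corr: "corr M RM (free0_conjunct c) (free1_conjunct c)"
      using V0 free0 free1 by (intro corr_Rel) auto
    show "sat_conjunct RM c"
    \<comment> \<open>This case rule also opens the \<open>All1\<close> inside
      \<open>CPU1\<close>.\<close>
    proof (cases c rule: enums_conjunct.cases)
      case (1 a)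
      then show ?thesis using corr_qf[of M RM a] corr enums satc by simp
    next
      case (2 a)
      then show ?thesis using corr_qf[of M RM a] corr enums satc by simp
    next
      case (3 q)
      then show ?thesis using corr_pu0[of M RM q] corr enums satc dist DsM by simp
    next
      case (4 Zs p)
      have "sat_prop (sat_comp1 (upd1 RM Zs Us)) p"
        if Us: "length Us = length Zs" "set Us \<subseteq> Pow Ds" for Us
      proof -
        \<comment> \<open>The universal conjunct, true in \<open>M\<close>, is instantiated with the
          lifted sets; its matrix is then carried over component by component.\<close>
        have "set (map lift Us) \<subseteq> Pow (Dom M)"
          using interp Us DsM by (auto simp: lift_def is_interp_def)
        then have "sat_prop (sat_comp1 (upd1 M Zs (map lift Us))) p"
          using satc 4 Us(1) by simp
        moreover have "sat_comp1 (upd1 RM Zs Us) b = sat_comp1 (upd1 M Zs (map lift Us)) b"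
          if b: "b \<in> set (components p)" for b
        proof (rule corr_comp1[OF interp DsM])
          show "Ind M ` free0_comp1 b \<subseteq> Ds" "free1_comp1 b - set Zs \<subseteq> ?V1"
            using b 4 free0 free1 V0 by (simp, blast) (use b 4 free1 in auto)
          show "length xs \<le> ?l" if "xs \<in> enums_comp1 b" for xs
            using that b 4 enums by auto
          show "distinct (bound0_comp1 b)"
            using dist(1) b 4 by (auto simp: distinct_concat_iff)
          show "linked TYPE('d) Zs q" if "b = PU0 q" for q
            using that b 4 norm c by (auto simp: normalized_def)
          show "\<exists>us. is_witness M (Zs, All0 zs r, Xs) us \<and> set us \<subseteq> Ds"
            if "b = PU0 (All0 zs r)" "length Xs = length Zs" "set Xs \<subseteq> ?V1"
              "\<not> sat_pu0 M (subst_pu0 Zs Xs (All0 zs r))" for zs r Xs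
          proof -
            \<comment> \<open>The witnesses that \<open>w\<close> picks for this instance were put
              into \<open>Ds\<close> by its construction.\<close>
            have "(Zs, All0 zs r, Xs) \<in> false_instances M \<psi>"
              using that b 4 c by (auto simp: false_instances_def Phi_def)
            then show ?thesis using wit by (auto simp: Ds_def simp del: is_witness.simps)
          qed
          show "distinct Zs" using dist(2) 4 by simp
        qed (use Us in auto)
        ultimately show ?thesis
          using sat_prop_cong[of p "sat_comp1 (upd1 RM Zs Us)"] by blast
      qed
      then show ?thesis using 4 by simp
    qed
  qed
qed

end
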